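(* Every graph in $\varepsilon_2$ has at least one vertex of degree $2$.
   Context: All graphs are finite, simple, undirected and connected. An Euler graph is a connected graph in which every vertex has even degree. $\varepsilon_2$ denotes the class of Euler graphs $G$ such that every cycle of $G$ has length $n\equiv 2 \pmod 4$.
   Formalization: The graph is assumed to have at least two vertices: the one-vertex graph is connected, has only the even degree 0 and no cycles, so it lies in ε₂ but has no vertex of degree 2. *)

theory Defs
  imports "Graph_Theory.Graph_Theory"
begin

text \<open>
  A finite simple undirected graph is a symmetric digraph without loops and parallel arcs
  (locale \<^locale>\<open>graph\<close>): each edge is a pair of opposite arcs. Hence the degree of a vertex is
  its out-degree, and a walk \<open>u, v, u\<close> along one edge satisfies \<^const>\<open>pre_digraph.cycle\<close>.
  The cycles of the undirected graph are those of length at least 3.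
\<close>

definition euler_graph :: "('a, 'b) pre_digraph \<Rightarrow> bool" where
  "euler_graph G \<longleftrightarrow>
     graph G \<and> Digraph_Component.connected G \<and> (\<forall>v \<in> verts G. even (out_degree G v))"

definition ucycle :: "('a, 'b) pre_digraph \<Rightarrow> 'b awalk \<Rightarrow> bool" where
  "ucycle G p \<longleftrightarrow> pre_digraph.cycle G p \<and> 3 \<le> length p"

definition \<epsilon>\<^sub>2 :: "('a, 'b) pre_digraph set" where
  "\<epsilon>\<^sub>2 = {G. euler_graph G \<and> (\<forall>p. ucycle G p \<longrightarrow> length p mod 4 = 2)}"

end

theory Submission
  imports Defs
begin

text \<open>
  Among the longest paths \<open>v\<^sub>0, v\<^sub>1, \<dots>\<close> of a graph of minimum degree at least 3, take one for which
  the last neighbour \<open>v\<^sub>j\<close> of \<open>v\<^sub>0\<close> on it is as early as possible, and let \<open>v\<^sub>i\<close> with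
  \<open>1 < i < j\<close> be another neighbour of \<open>v\<^sub>0\<close>. Then \<open>v\<^bsub>i-1\<^esub>, \<dots>, v\<^sub>0, v\<^sub>i, v\<^bsub>i+1\<^esub>, \<dots>\<close> is again a longest
  path, so by the choice of \<open>j\<close> its first vertex has a neighbour \<open>v\<^sub>t\<close> with \<open>t \<ge> j\<close>. The cycles
  \<open>v\<^sub>0 \<dots> v\<^sub>j\<close>, \<open>v\<^bsub>i-1\<^esub> \<dots> v\<^sub>0 v\<^sub>i \<dots> v\<^sub>t\<close> and \<open>v\<^sub>0 v\<^sub>i v\<^bsub>i-1\<^esub> v\<^sub>t v\<^bsub>t-1\<^esub> \<dots> v\<^sub>j\<close> have lengths
  \<open>j + 1\<close>, \<open>t + 1\<close> and \<open>4 + t - j\<close>, which cannot all be \<open>2\<close> modulo 4.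
\<close>

lemma successively_take: "successively P xs \<Longrightarrow> successively P (take n xs)"
  by (metis append_take_drop_id successively_append_iff)

lemma successively_drop: "successively P xs \<Longrightarrow> successively P (drop n xs)"
  by (metis append_take_drop_id successively_append_iff)

text \<open>The argument cuts, reverses and splices paths, so it runs on distinct vertex lists over
  a relation \<open>E\<close>. A list whose last entry is adjacent to its first stands for a cycle
  with as many edges as entries.\<close>

lemma min_degree_3_cycle_mod_4:
  fixes E :: "'a \<Rightarrow> 'a \<Rightarrow> bool" and V :: "'a set"
  assumes fin: "finite V" and ne: "V \<noteq> {}"
    and sym: "symp E" and irr: "irreflp E"
    and closed: "\<And>u v. E u v \<Longrightarrow> v \<in> V"
    and deg: "\<And>v. v \<in> V \<Longrightarrow> 3 \<le> card {w. E v w}"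
  obtains xs where "distinct xs" "set xs \<subseteq> V" "successively E xs" "E (last xs) (hd xs)"
    "3 \<le> length xs" "length xs mod 4 \<noteq> 2"
proof (rule ccontr)
  assume no: "\<not> thesis"
  note found = that
  have cyc: "length xs mod 4 = 2"
    if "distinct xs" "set xs \<subseteq> V" "successively E xs" "E (last xs) (hd xs)" "3 \<le> length xs" for xs
    using that no found by blast
  have flip: "E v u" if "E u v" for u v
    using sym that by (auto dest: sympD)
  have "(\<lambda>u v. E v u) = E" using flip by blast
  then have succ_rev: "successively E (rev xs) \<longleftrightarrow> successively E xs" for xs
    by (subst successively_rev) (rule arg_cong[where f = "\<lambda>R. successively R xs"])
  define path where "path xs \<longleftrightarrow> xs \<noteq> [] \<and> distinct xs \<and> set xs \<subseteq> V \<and> successively E xs" for xs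
  obtain v where "v \<in> V" using ne by blast
  then have "path [v]" by (simp add: path_def)
  moreover have "length xs < Suc (card V)" if "path xs" for xs
    using that fin by (metis path_def distinct_card card_mono le_imp_less_Suc)
  ultimately obtain zs where zs: "path zs" and zs_max: "\<And>xs. path xs \<Longrightarrow> length xs \<le> length zs"
    using ex_has_greatest_nat[of path "[v]" length "Suc (card V)"] by blast
  define longest where "longest xs \<longleftrightarrow> path xs \<and> length xs = length zs" for xs
  \<comment> \<open>Positions instead of vertices, so that \<open>Max (N xs)\<close> locates the
    last neighbour of the first vertex along the path.\<close>
  define N where "N xs = {k. k < length xs \<and> E (hd xs) (xs ! k)}" for xs
  have finN: "finite (N xs)" for xs by (simp add: N_def)
  \<comment> \<open>A neighbour off the path could be prepended, giving a longer path.\<close>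
  have nbr: "w \<in> set xs" if "longest xs" "E (hd xs) w" for xs w
  proof (rule ccontr)
    assume "w \<notin> set xs"
    then have "path (w # xs)"
      using that closed flip by (auto simp: longest_def path_def successively_Cons)
    then show False using zs_max[of "w # xs"] that by (simp add: longest_def)
  qed
  have cardN: "3 \<le> card (N xs)" if "longest xs" for xs
  proof -
    have "{w. E (hd xs) w} \<subseteq> (!) xs ` N xs"
      using nbr[OF that] by (fastforce simp: N_def in_set_conv_nth)
    then have "card {w. E (hd xs) w} \<le> card (N xs)"
      using finN by (meson card_image_le card_mono finite_imageI le_trans)
    moreover have "hd xs \<in> V" using that by (auto simp: longest_def path_def)
    ultimately show ?thesis using deg[of "hd xs"] by simp
  qed
  obtain xs where xs: "longest xs" and xs_min: "\<And>ys. longest ys \<Longrightarrow> Max (N xs) \<le> Max (N ys)"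
    using ex_has_least_nat[of longest zs "\<lambda>xs. Max (N xs)"] zs by (auto simp: longest_def)
  have p: "xs \<noteq> []" "distinct xs" "set xs \<subseteq> V" "successively E xs"
    using xs by (auto simp: longest_def path_def)
  define j where "j = Max (N xs)"
  have "N xs \<noteq> {}" using cardN[OF xs] by auto
  then have jN: "j \<in> N xs" using finN Max_in by (simp add: j_def)
  \<comment> \<open>Three positions in \<open>N xs\<close> leave one besides 1 and \<open>j\<close>.
    Excluding 1 makes \<open>xs ! (i - 1)\<close> differ from \<open>xs ! 0\<close>, as the third
    cycle requires.\<close>
  have "card {1, j} \<le> 2" by (simp add: card_insert_if)
  then have "\<not> N xs \<subseteq> {1, j}"
    using cardN[OF xs] card_mono[of "{1, j}" "N xs"] by fastforce
  then obtain i where iN: "i \<in> N xs" "i \<noteq> 1" "i \<noteq> j" by blast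
  have "0 \<notin> N xs" using irr p(1) by (auto simp: N_def hd_conv_nth dest: irreflpD)
  then have "i \<noteq> 0" using iN by metis
  then have i2: "2 \<le> i" using iN by simp
  have ij: "i < j" using iN Max_ge[OF finN, of i xs] by (simp add: j_def)
  have jl: "j < length xs" and Ej: "E (xs ! 0) (xs ! j)" and Ei: "E (xs ! 0) (xs ! i)"
    using jN iN p(1) by (auto simp: N_def hd_conv_nth)
  \<comment> \<open>The edge from \<open>xs ! 0\<close> to \<open>xs ! i\<close> joins the two
    pieces. Entries from position \<open>i\<close> on stay in place, so
    \<open>ys ! t = xs ! t\<close> once \<open>j \<le> t\<close> is known.\<close>
  define ys where "ys = rev (take i xs) @ drop i xs"
  have hd_take: "hd (take i xs) = xs ! 0" "last (take i xs) = xs ! (i - 1)" "take i xs \<noteq> []"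
    using i2 ij jl p(1) by (auto simp: hd_conv_nth last_conv_nth min_def)
  have len: "length ys = length xs" by (simp add: ys_def)
  have hd_ys: "hd ys = xs ! (i - 1)" using hd_take by (simp add: ys_def hd_rev)
  have set_ys: "set ys = set xs"
    by (metis append_take_drop_id set_append set_rev ys_def)
  have "distinct ys"
    using p(2) len set_ys by (metis card_distinct distinct_card)
  moreover have "successively E ys"
  proof -
    have "successively E (rev (take i xs))"
      using p(4) by (simp only: succ_rev successively_take)
    then show ?thesis using p(4) hd_take Ei ij jl
      by (simp add: ys_def successively_append_iff successively_drop last_rev hd_drop_conv_nth
          del: successively_rev)
  qed
  ultimately have "longest ys" and q: "distinct ys" "successively E ys"
    using p xs set_ys len by (auto simp: longest_def path_def)
  define t where "t = Max (N ys)"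
  have "N ys \<noteq> {}" using cardN[OF \<open>longest ys\<close>] by auto
  then have tN: "t \<in> N ys" using finN Max_in by (simp add: t_def)
  have jt: "j \<le> t" using xs_min[OF \<open>longest ys\<close>] by (simp add: j_def t_def)
  have tl: "t < length xs" and ys_t: "ys ! t = xs ! t"
    using tN len jt ij by (auto simp: N_def ys_def nth_append)
  have Et: "E (xs ! (i - 1)) (xs ! t)"
    using tN hd_ys ys_t by (simp add: N_def)
  have "length (take (j + 1) xs) mod 4 = 2"
    by (rule cyc) (use p Ej jl i2 ij flip in
        \<open>auto simp: successively_take last_conv_nth hd_conv_nth dest: in_set_takeD\<close>)
  then have 1: "(j + 1) mod 4 = 2" using jl by simp
  have "length (take (t + 1) ys) mod 4 = 2"
  proof (rule cyc)
    have "last (take (t + 1) ys) = xs ! t" using tl len ys_t by (simp add: take_Suc_conv_app_nth)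
    then show "E (last (take (t + 1) ys)) (hd (take (t + 1) ys))"
      using flip[OF Et] hd_ys by simp
  qed (use p q set_ys len tl jt ij i2 in \<open>auto simp: successively_take dest: in_set_takeD\<close>)
  then have 2: "(t + 1) mod 4 = 2" using tl len by simp
  \<comment> \<open>The stretch from \<open>xs ! j\<close> to \<open>xs ! t\<close>, a single vertex
    if \<open>t = j\<close>. It starts beyond position \<open>i\<close>, hence avoids the three
    vertices put in front of it below.\<close>
  define ms where "ms = take (t + 1 - j) (drop j xs)"
  have ms: "length ms = t + 1 - j" "hd ms = xs ! j" "last ms = xs ! t" "ms \<noteq> []"
    using jt tl jl by (auto simp: ms_def hd_drop_conv_nth last_conv_nth)
  have notin: "xs ! k \<notin> set ms" if "k < j" for k
    using that p(2) jl by (auto simp: ms_def in_set_conv_nth nth_eq_iff_index_eq)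
  have "length ([xs ! 0, xs ! i, xs ! (i - 1)] @ rev ms) mod 4 = 2"
  proof (rule cyc)
    have d: "xs ! 0 \<noteq> xs ! i" "xs ! 0 \<noteq> xs ! (i - 1)" "xs ! i \<noteq> xs ! (i - 1)"
      using i2 ij jl by (simp_all add: nth_eq_iff_index_eq[OF p(2)] del: length_greater_0_conv)
    show "distinct ([xs ! 0, xs ! i, xs ! (i - 1)] @ rev ms)"
      using d notin i2 ij p(2) by (auto simp: ms_def)
    show "set ([xs ! 0, xs ! i, xs ! (i - 1)] @ rev ms) \<subseteq> V"
    proof -
      have nth_V: "xs ! k \<in> V" if "k < length xs" for k
        using p(3) nth_mem[OF that] by (rule subsetD)
      have "set ms \<subseteq> set xs"
        unfolding ms_def using set_take_subset set_drop_subset by (rule subset_trans)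
      then have "set ms \<subseteq> V" using p(3) by (rule subset_trans)
      then show ?thesis using nth_V[of 0] nth_V[of i] nth_V[of "i - 1"] ij jl p(1) by simp
    qed
    have "E (xs ! i) (xs ! (i - 1))"
      using successively_nth[OF p(4), of "i - 1"] i2 ij jl flip by simp
    moreover have "successively E (rev ms)"
      using p(4) by (simp only: succ_rev ms_def successively_take successively_drop)
    ultimately show "successively E ([xs ! 0, xs ! i, xs ! (i - 1)] @ rev ms)"
      using Ei Et ms by (simp add: successively_Cons hd_rev del: successively_rev)
    show "E (last ([xs ! 0, xs ! i, xs ! (i - 1)] @ rev ms))
        (hd ([xs ! 0, xs ! i, xs ! (i - 1)] @ rev ms))"
      using flip[OF Ej] ms by (simp add: last_rev)
  qed simp
  then have "(4 + (t - j)) mod 4 = 2" using ms jt by (simp add: algebra_simps)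
  then have 3: "(t - j) mod 4 = 2" by simp
  \<comment> \<open>The cycle conditions make the right-hand side 2 + 2 = 0 modulo 4, while the
    left-hand side is 2.\<close>
  have "(t + 1) mod 4 = ((j + 1) mod 4 + (t - j) mod 4) mod 4"
    using jt by (simp add: mod_add_eq)
  then show False using 1 2 3 by simp
qed

context wf_digraph
begin

text \<open>Passes from vertex lists to the arc lists that \<open>cycle\<close> speaks of, by
  choosing an arc for each consecutive pair.\<close>

lemma successively_dominates_imp_awalk:
  assumes "xs \<noteq> []" "set xs \<subseteq> verts G" "successively (\<lambda>u v. u \<rightarrow> v) xs"
  obtains p where "awalk (hd xs) p (last xs)" "awalk_verts (hd xs) p = xs"
  using assms
proof (induction xs arbitrary: thesis rule: induct_list012)
  case (2 x)
  show ?case by (rule "2.prems"(1)[of "[]"]) (use 2 in \<open>auto simp: awalk_Nil_iff\<close>)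
next
  case (3 x y zs)
  from "3.prems" obtain p where p: "awalk y p (last (y # zs))" "awalk_verts y p = y # zs"
    using "3.IH"(2) by auto
  from "3.prems" obtain e where e: "e \<in> arcs G" "tail G e = x" "head G e = y"
    by auto
  show ?case
    by (rule "3.prems"(1)[of "e # p"]) (use p e in \<open>auto simp: awalk_Cons_iff\<close>)
qed simp

lemma successively_dominates_imp_cycle:
  assumes "distinct xs" "xs \<noteq> []" "set xs \<subseteq> verts G"
    and "successively (\<lambda>u v. u \<rightarrow> v) xs" "last xs \<rightarrow> hd xs"
  obtains p where "cycle p" "length p = length xs"
proof -
  obtain p where p: "awalk (hd xs) p (last xs)" "awalk_verts (hd xs) p = xs"
    using successively_dominates_imp_awalk assms by blast
  obtain e where e: "e \<in> arcs G" "tail G e = last xs" "head G e = hd xs"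
    using assms(5) by auto
  \<comment> \<open>With the closing arc in front, the vertex list without its first entry is
    exactly \<open>xs\<close>, and this is the list that \<open>cycle\<close> requires to be
    distinct.\<close>
  have "awalk (last xs) (e # p) (last xs)"
    using p e by (auto simp: awalk_Cons_iff)
  moreover have "tl (awalk_verts (last xs) (e # p)) = xs" using p e by simp
  ultimately have "cycle (e # p)" using assms(1) by (auto simp: cycle_def)
  moreover have "length (e # p) = length xs" using p(2) length_awalk_verts by (metis length_Cons)
  ultimately show thesis by (rule that)
qed

end

text \<open>Without parallel arcs, \<open>head G\<close> is injective on the arcs leaving
  \<open>v\<close>.\<close>

lemma (in nomulti_digraph) out_degree_eq_card_dominated: "out_degree G v = card {w. v \<rightarrow> w}"
proof -
  have "inj_on (head G) (out_arcs G v)"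
    using no_multi_arcs by (auto simp: inj_on_def arc_to_ends_def)
  moreover have "head G ` out_arcs G v = {w. v \<rightarrow> w}"
    by (auto simp: arcs_ends_conv image_iff)
  ultimately show ?thesis by (metis card_image out_degree_def)
qed

theorem theorem14:
  fixes G :: "('a, 'b) pre_digraph"
  assumes "G \<in> \<epsilon>\<^sub>2"
    and nontrivial: "card (verts G) \<ge> 2"
  shows "\<exists>v \<in> verts G. out_degree G v = 2"
proof (rule ccontr)
  assume no2: "\<not> ?thesis"
  have conn: "Digraph_Component.connected G" and ev: "\<And>v. v \<in> verts G \<Longrightarrow> even (out_degree G v)"
    and cyc: "\<And>p. ucycle G p \<Longrightarrow> length p mod 4 = 2" and "graph G"
    using assms(1) by (auto simp: \<epsilon>\<^sub>2_def euler_graph_def)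
  interpret graph G by fact
  have deg: "3 \<le> card {w. v \<rightarrow>\<^bsub>G\<^esub> w}" if v: "v \<in> verts G" for v
  proof -
    have "\<not> verts G \<subseteq> {v}" using nontrivial card_mono[of "{v}" "verts G"] by auto
    then obtain u where u: "u \<in> verts G" "u \<noteq> v" by blast
    \<comment> \<open>Connectedness is defined through the symmetric closure, which has the same
      reachability as the symmetric \<open>G\<close>. A walk to \<open>u \<noteq> v\<close> must
      leave \<open>v\<close> by an arc, so the degree is not 0.\<close>
    have "v \<rightarrow>\<^sup>*\<^bsub>G\<^esub> u"
      using conn v u reachable_mk_symmetric_eq[OF sym_arcs]
      by (auto simp: connected_def strongly_connected_def)
    then obtain w where "v \<rightarrow>\<^bsub>G\<^esub> w" using u(2) by (auto elim: converse_reachable_cases)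
    then have "out_arcs G v \<noteq> {}" by (auto simp: arcs_ends_conv out_arcs_def)
    then have "out_degree G v \<noteq> 0" by (simp add: out_degree_def finite_out_arcs)
    moreover have "out_degree G v \<noteq> 2" using no2 v by blast
    ultimately have "3 \<le> out_degree G v" using ev[OF v] by presburger
    then show ?thesis by (simp add: out_degree_eq_card_dominated)
  qed
  have symp: "symp (\<lambda>u v. u \<rightarrow>\<^bsub>G\<^esub> v)"
    by (auto simp: symp_def intro: arcs_ends_symmetric[OF sym_arcs])
  have irreflp: "irreflp (\<lambda>u v. u \<rightarrow>\<^bsub>G\<^esub> v)" using adj_not_same by (auto simp: irreflp_def)
  have "verts G \<noteq> {}" using nontrivial by auto
  then obtain xs where xs: "distinct xs" "set xs \<subseteq> verts G" "successively (\<lambda>u v. u \<rightarrow>\<^bsub>G\<^esub> v) xs"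
    "last xs \<rightarrow>\<^bsub>G\<^esub> hd xs" "3 \<le> length xs" "length xs mod 4 \<noteq> 2"
    by (rule min_degree_3_cycle_mod_4[OF finite_verts _ symp irreflp adj_in_verts(2) deg])
  moreover have "xs \<noteq> []" using xs(5) by auto
  ultimately obtain p where "cycle p" "length p = length xs"
    using successively_dominates_imp_cycle by blast
  then show False using cyc[of p] xs by (simp add: ucycle_def)
qed

end
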